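(* For every integer $n\ge 3$, the book graph $B_n$ satisfies $\operatorname{st}_{\gamma_{st}}(B_n)=1$.
   Context: All graphs are finite, simple and undirected. For a graph $G=(V,E)$, a set $D\subseteq V$ is a strong dominating set if every vertex $v\in V\setminus D$ is adjacent to some $u\in D$ with $\deg(v)\le\deg(u)$ (degrees taken in $G$). The strong domination number $\gamma_{st}(G)$ is the minimum size of a strong dominating set. For $S\subseteq V$, $G-S$ is the graph obtained by deleting the vertices of $S$. The stability of the strong domination number is $\operatorname{st}_{\gamma_{st}}(G)=\min\{|S| : S\subseteq V,\ \gamma_{st}(G-S)\ne\gamma_{st}(G)\}$. The book graph $B_n$ is the Cartesian product $K_{1,n}\,\square\,P_2$ of the star $K_{1,n}$ with the path on two vertices; it consists of $n$ $4$-cycles sharing a common edge. *)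

theory Defs
  imports Graph_Theory.Graph_Theory
begin

text \<open>
  Finite simple graphs are the digraphs satisfying \<^locale>\<open>graph\<close> (finite, loop-free, symmetric,
  no parallel arcs). An edge is a pair of opposite arcs, so the degree of a vertex is its
  \<^const>\<open>out_degree\<close>, and \<^const>\<open>dominates\<close> (written with an arrow) is the adjacency relation.
\<close>

definition strong_dominating_set :: "('a, 'b) pre_digraph \<Rightarrow> 'a set \<Rightarrow> bool" where
  "strong_dominating_set G D \<longleftrightarrow>
     D \<subseteq> verts G \<and>
     (\<forall>v \<in> verts G - D. \<exists>u \<in> D. v \<rightarrow>\<^bsub>G\<^esub> u \<and> out_degree G v \<le> out_degree G u)"

definition strong_domination_number :: "('a, 'b) pre_digraph \<Rightarrow> nat" where
  "strong_domination_number G = Min {card D | D. strong_dominating_set G D}"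

text \<open>
  Degrees in the vertex-deleted graph are taken in that graph. The null graph, which arises by
  deleting every vertex, is allowed and has strong domination number 0.
\<close>

definition strong_domination_stability :: "('a, 'b) pre_digraph \<Rightarrow> nat" where
  "strong_domination_stability G =
     Min {card S | S. S \<subseteq> verts G \<and>
       strong_domination_number (G \<restriction> (verts G - S)) \<noteq> strong_domination_number G}"

definition cartesian_product ::
  "'a pair_pre_digraph \<Rightarrow> 'b pair_pre_digraph \<Rightarrow> ('a \<times> 'b) pair_pre_digraph" where
  "cartesian_product G H =
     \<lparr> pverts = pverts G \<times> pverts H,
       parcs = {((a, b), (a', b')).
         (a = a' \<and> a \<in> pverts G \<and> (b, b') \<in> parcs H) \<or>
         (b = b' \<and> b \<in> pverts H \<and> (a, a') \<in> parcs G)} \<rparr>"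

text \<open>The star with centre 0 and leaves 1, ..., n.\<close>

definition star_graph :: "nat \<Rightarrow> nat pair_pre_digraph" where
  "star_graph n = \<lparr> pverts = {0..n}, parcs = {0} \<times> {1..n} \<union> {1..n} \<times> {0} \<rparr>"

text \<open>The path on the n vertices 0, ..., n - 1.\<close>

definition path_graph :: "nat \<Rightarrow> nat pair_pre_digraph" where
  "path_graph n =
     \<lparr> pverts = {..<n}, parcs = {(i, j). i < n \<and> j < n \<and> (j = Suc i \<or> i = Suc j)} \<rparr>"

definition book_graph :: "nat \<Rightarrow> (nat \<times> nat) pair_pre_digraph" where
  "book_graph n = cartesian_product (star_graph n) (path_graph 2)"

lemma pair_graph_cartesian_product:
  assumes "pair_graph G" "pair_graph H"
  shows "pair_graph (cartesian_product G H)"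
proof -
  interpret G: pair_graph G by fact
  interpret H: pair_graph H by fact
  have sG: "(b, a) \<in> parcs G" if "(a, b) \<in> parcs G" for a b
    using G.pair_sym_arcs that by (auto simp: symmetric_def sym_def)
  have sH: "(b, a) \<in> parcs H" if "(a, b) \<in> parcs H" for a b
    using H.pair_sym_arcs that by (auto simp: symmetric_def sym_def)
  have sub: "parcs (cartesian_product G H) \<subseteq>
      (pverts G \<times> pverts H) \<times> (pverts G \<times> pverts H)"
    by (auto simp: cartesian_product_def dest: G.in_arcsD1 G.in_arcsD2 H.in_arcsD1 H.in_arcsD2)
  show ?thesis
  proof
    show "finite (pverts (cartesian_product G H))"
      by (simp add: cartesian_product_def G.pair_finite_verts H.pair_finite_verts)
    show "finite (parcs (cartesian_product G H))"
      by (rule finite_subset[OF sub]) (simp add: G.pair_finite_verts H.pair_finite_verts)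
    show "symmetric (with_proj (cartesian_product G H))"
      by (auto simp: symmetric_def sym_def cartesian_product_def intro: sG sH)
  next
    fix e assume e: "e \<in> parcs (cartesian_product G H)"
    show "fst e \<in> pverts (cartesian_product G H)" "snd e \<in> pverts (cartesian_product G H)"
      using e sub by (auto simp: cartesian_product_def
        dest: G.in_arcsD1 G.in_arcsD2 H.in_arcsD1 H.in_arcsD2)
    show "fst e \<noteq> snd e"
      using e by (auto simp: cartesian_product_def dest: G.pair_no_loops H.pair_no_loops)
  qed
qed

lemma pair_graph_star_graph: "pair_graph (star_graph n)"
  by unfold_locales (auto simp: star_graph_def symmetric_def sym_def)

lemma star_graph_complete_bipartite: "K\<^bsub>1,n\<^esub> (with_proj (star_graph n))"
  unfolding complete_bipartite_digraph_pair_def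
  by (intro conjI exI[of _ "{0}"] exI[of _ "{1..n}"]) (auto simp: star_graph_def)

lemma pair_graph_path_graph: "pair_graph (path_graph n)"
proof unfold_locales
  show "finite (parcs (path_graph n))"
    by (rule finite_subset[of _ "{..<n} \<times> {..<n}"]) (auto simp: path_graph_def)
qed (auto simp: path_graph_def symmetric_def sym_def)

lemma pair_graph_book_graph: "pair_graph (book_graph n)"
  unfolding book_graph_def
  by (intro pair_graph_cartesian_product pair_graph_star_graph pair_graph_path_graph)

end

theory Submission
  imports Defs
begin

text \<open>
  The two hubs strongly dominate the book, and pages 1 and 2 contain vertices on opposite sides with
  disjoint closed neighbourhoods, so the strong domination number is 2. Once a hub is deleted, its
  \<^term>\<open>n\<close> former leaf neighbours have pairwise disjoint closed neighbourhoods, so the number rises to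
  at least \<^term>\<open>n\<close>, which exceeds 2.
\<close>

text \<open>\<open>Min\<close> obeys its usual laws only on finite sets; this makes them available
  for the strong domination number.\<close>

lemma finite_strong_dominating_sets:
  assumes "finite (verts G)"
  shows "finite {card D | D. strong_dominating_set G D}"
proof -
  have "{card D | D. strong_dominating_set G D} \<subseteq> card ` Pow (verts G)"
    by (auto simp: strong_dominating_set_def)
  then show ?thesis
    using assms by (meson finite_Pow_iff finite_imageI finite_subset)
qed

lemma strong_domination_number_le:
  assumes "finite (verts G)" "strong_dominating_set G D"
  shows "strong_domination_number G \<le> card D"
  unfolding strong_domination_number_def
  by (rule Min_le[OF finite_strong_dominating_sets]) (use assms in auto)

text \<open>A dominating set meets the closed neighbourhood of every vertex of \<open>P\<close>. The
  assumption \<open>disj\<close> makes these neighbourhoods pairwise disjoint, so choosing a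
  dominator \<open>g v\<close> for each \<open>v\<close> is injective. Only adjacency matters here,
  not degrees.\<close>

lemma card_packing_le_strong_domination_number:
  assumes fin: "finite (verts G)" and P: "P \<subseteq> verts G"
    and disj: "\<And>v w u. \<lbrakk>v \<in> P; w \<in> P; v = u \<or> v \<rightarrow>\<^bsub>G\<^esub> u; w = u \<or> w \<rightarrow>\<^bsub>G\<^esub> u\<rbrakk> \<Longrightarrow> v = w"
  shows "card P \<le> strong_domination_number G"
proof -
  have "card P \<le> card D" if D: "strong_dominating_set G D" for D
  proof -
    have "\<forall>v \<in> P. \<exists>u \<in> D. v = u \<or> v \<rightarrow>\<^bsub>G\<^esub> u"
      using D P unfolding strong_dominating_set_def by blast
    then obtain g where g: "\<And>v. v \<in> P \<Longrightarrow> g v \<in> D \<and> (v = g v \<or> v \<rightarrow>\<^bsub>G\<^esub> g v)"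
      by metis
    have "inj_on g P"
      by (rule inj_onI) (metis disj g)
    moreover have "finite D"
      using D fin by (auto simp: strong_dominating_set_def intro: finite_subset)
    ultimately show ?thesis
      using g by (intro card_inj_on_le) auto
  qed
  \<comment> \<open>\<open>Min_ge_iff\<close> also requires a nonempty set; the full vertex set is a
    witness.\<close>
  moreover have "strong_dominating_set G (verts G)"
    by (simp add: strong_dominating_set_def)
  ultimately show ?thesis
    unfolding strong_domination_number_def
    by (subst Min_ge_iff[OF finite_strong_dominating_sets[OF fin]]) auto
qed

lemma (in fin_digraph) strong_domination_stability_eq_1:
  assumes v: "v \<in> verts G"
    and neq: "strong_domination_number (G \<restriction> (verts G - {v})) \<noteq> strong_domination_number G"
  shows "strong_domination_stability G = 1"
proof -
  let ?A = "{card S | S. S \<subseteq> verts G \<and>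
    strong_domination_number (G \<restriction> (verts G - S)) \<noteq> strong_domination_number G}"
  have "?A \<subseteq> card ` Pow (verts G)" by auto
  then have "finite ?A"
    by (meson finite_Pow_iff finite_imageI finite_subset finite_verts)
  moreover have "1 \<in> ?A"
    using v neq by (intro CollectI exI[of _ "{v}"]) auto
  moreover have "1 \<le> k" if "k \<in> ?A" for k
  proof -
    obtain S where S: "k = card S" "S \<subseteq> verts G"
      "strong_domination_number (G \<restriction> (verts G - S)) \<noteq> strong_domination_number G"
      using \<open>k \<in> ?A\<close> by auto
    \<comment> \<open>Deleting nothing cannot change the number, so 0 is never attained.\<close>
    have "G \<restriction> verts G = G"
      by (rule pre_digraph.equality) auto
    then have "S \<noteq> {}"
      using S(3) by auto
    then show ?thesis
      using S(1,2) finite_subset[OF _ finite_verts] by (simp add: Suc_le_eq card_gt_0_iff)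
  qed
  ultimately show ?thesis
    unfolding strong_domination_stability_def by (intro Min_eqI) auto
qed

text \<open>In a vertex \<open>(a, b)\<close>, \<open>a = 0\<close> marks a hub,
  \<open>a \<ge> 1\<close> is the page, and \<open>b\<close> is the side.\<close>

lemma pverts_book_graph: "pverts (book_graph n) = {0..n} \<times> {..<2}"
  by (simp add: book_graph_def cartesian_product_def star_graph_def path_graph_def)

lemma parcs_book_graph:
  "((a, b), (a', b')) \<in> parcs (book_graph n) \<longleftrightarrow>
     a \<le> n \<and> a' \<le> n \<and> b < 2 \<and> b' < 2 \<and>
     (a = a' \<and> b \<noteq> b' \<or> b = b' \<and> (a = 0 \<and> a' \<noteq> 0 \<or> a \<noteq> 0 \<and> a' = 0))"
  by (auto simp: book_graph_def cartesian_product_def star_graph_def path_graph_def)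

lemma out_degree_book_graph_leaf_le:
  assumes "a \<noteq> 0"
  shows "out_degree (with_proj (book_graph n)) (a, b) \<le> 2"
proof -
  \<comment> \<open>A leaf sees the hub of its own side and its partner on the other side,
    \<open>1 - b\<close> swapping 0 and 1. Pairs outside the vertex set have no arcs, so the
    inclusion holds for them too.\<close>
  have "out_arcs (with_proj (book_graph n)) (a, b) \<subseteq> {((a, b), (0, b)), ((a, b), (a, 1 - b))}"
    using assms by (auto simp: out_arcs_def parcs_book_graph)
  then have "out_degree (with_proj (book_graph n)) (a, b)
      \<le> card {((a, b), (0, b)), ((a, b), (a, 1 - b))}"
    unfolding out_degree_def by (intro card_mono) auto
  also have "\<dots> \<le> 2"
    by (simp add: card_insert_if)
  finally show ?thesis .
qed

lemma out_degree_book_graph_hub_ge: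
  assumes "b < 2"
  shows "n \<le> out_degree (with_proj (book_graph n)) (0, b)"
proof -
  interpret pair_graph "book_graph n" by (rule pair_graph_book_graph)
  \<comment> \<open>Counting only the arcs to leaves of the same side is enough; the arc to the
    other hub is left out.\<close>
  have "card ((\<lambda>a. ((0 :: nat, b), (a, b))) ` {1..n})
      \<le> out_degree (with_proj (book_graph n)) (0, b)"
    unfolding out_degree_def
    by (intro card_mono) (use assms in \<open>auto simp: out_arcs_def parcs_book_graph\<close>)
  then show ?thesis
    by (simp add: card_image inj_on_def)
qed

lemma strong_domination_number_book_graph:
  assumes "n \<ge> 2"
  shows "strong_domination_number (with_proj (book_graph n)) = 2"
proof (rule antisym)
  have dom: "strong_dominating_set (with_proj (book_graph n)) {(0, 0), (0, 1)}"
    unfolding strong_dominating_set_def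
  proof (intro conjI ballI)
    show "{(0, 0), (0, 1)} \<subseteq> verts (with_proj (book_graph n))"
      by (auto simp: pverts_book_graph)
  next
    fix v assume v: "v \<in> verts (with_proj (book_graph n)) - {(0, 0), (0, 1)}"
    obtain a b where ab: "v = (a, b)" by (cases v)
    with v have b: "a \<noteq> 0" "a \<le> n" "b < 2"
      by (auto simp: pverts_book_graph less_2_cases_iff)
    \<comment> \<open>The degree condition follows from 2 \<le> n: leaf degree at most 2, hub degree
      at least n.\<close>
    have "out_degree (with_proj (book_graph n)) v \<le> out_degree (with_proj (book_graph n)) (0, b)"
      using out_degree_book_graph_leaf_le[OF b(1), of n b] out_degree_book_graph_hub_ge[OF b(3), of n]
        assms unfolding ab by linarith
    moreover have "v \<rightarrow>\<^bsub>with_proj (book_graph n)\<^esub> (0, b)"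
      using b ab by (simp add: parcs_book_graph)
    moreover have "(0, b) \<in> {(0, 0), (0 :: nat, 1)}"
      using b by auto
    ultimately show "\<exists>u \<in> {(0, 0), (0, 1)}. v \<rightarrow>\<^bsub>with_proj (book_graph n)\<^esub> u \<and>
        out_degree (with_proj (book_graph n)) v \<le> out_degree (with_proj (book_graph n)) u"
      by blast
  qed
  then show "strong_domination_number (with_proj (book_graph n)) \<le> 2"
    using strong_domination_number_le[OF _ dom] by (simp add: pverts_book_graph)
next
  \<comment> \<open>The closed neighbourhoods are \<open>{(1, 0), (0, 0), (1, 1)}\<close> and
    \<open>{(2, 1), (0, 1), (2, 0)}\<close>.\<close>
  have "card {(1 :: nat, 0 :: nat), (2, 1)} \<le> strong_domination_number (with_proj (book_graph n))"
    by (rule card_packing_le_strong_domination_number)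
      (use assms in \<open>auto simp: pverts_book_graph parcs_book_graph\<close>)
  then show "2 \<le> strong_domination_number (with_proj (book_graph n))"
    by simp
qed

text \<open>Without the hub \<open>(0, 0)\<close>, the only neighbour of a leaf
  \<open>(a, 0)\<close> is \<open>(a, 1)\<close>, so the side-0 leaves form a packing.\<close>

lemma strong_domination_number_book_graph_minus_hub_ge:
  "n \<le> strong_domination_number
     (with_proj (book_graph n) \<restriction> (verts (with_proj (book_graph n)) - {(0, 0)}))"
proof -
  have "card ({1..n} \<times> {0 :: nat}) \<le> strong_domination_number
     (with_proj (book_graph n) \<restriction> (verts (with_proj (book_graph n)) - {(0, 0)}))"
    by (rule card_packing_le_strong_domination_number)
      (auto simp: pverts_book_graph parcs_book_graph arcs_ends_def arc_to_ends_def)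
  then show ?thesis
    by (simp add: card_cartesian_product)
qed

theorem proposition2p7:
  fixes n :: nat
  assumes "n \<ge> 3"
  shows "strong_domination_stability (with_proj (book_graph n)) = 1"
proof -
  interpret pair_graph "book_graph n" by (rule pair_graph_book_graph)
  show ?thesis
  proof (rule fin_digraph.strong_domination_stability_eq_1[OF fin_digraph_axioms])
    show "(0, 0) \<in> verts (with_proj (book_graph n))"
      by (simp add: pverts_book_graph)
    show "strong_domination_number
        (with_proj (book_graph n) \<restriction> (verts (with_proj (book_graph n)) - {(0, 0)}))
      \<noteq> strong_domination_number (with_proj (book_graph n))"
      \<comment> \<open>These two bounds conflict with equality only once n > 2, which is where
        \<open>n \<ge> 3\<close> enters.\<close>
      using strong_domination_number_book_graph_minus_hub_ge[of n] strong_domination_number_book_graph[of n]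
        assms by linarith
  qed
qed

end
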